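(* For every integer $n\ge 5$, $$\sum_{i=1}^{n-5} (n-i)(-1)^{i}F_i+6(-1)^{n-4}F_{n-4}=(-1)^nF_{n-1}-(n-2).$$
   Context: The Fibonacci numbers are $F_1=F_2=1$ and $F_k=F_{k-1}+F_{k-2}$ for $k\ge 3$. An empty sum equals $0$. *)

theory Defs
  imports "HOL-Number_Theory.Fib"
begin

end

theory Submission
  imports Defs
begin

text \<open>Summation by parts yields the coefficients \<open>F\<^bsub>m-1\<^esub> = F\<^bsub>m+1\<^esub> - F\<^bsub>m\<^esub>\<close>
  and \<open>F\<^bsub>m-3\<^esub> = 2 F\<^bsub>m+1\<^esub> - 3 F\<^bsub>m\<^esub>\<close>; they are written without subtraction in the
  indices so that the identity holds for every \<open>m\<close>.\<close>

lemma sum_linear_alternating_fib: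
  fixes x :: int and m :: nat
  shows "(\<Sum>i = 1..m. (x - int i) * (-1) ^ i * int (fib i))
         = (-1) ^ m * ((x - int m) * (int (fib (Suc m)) - int (fib m))
             - (2 * int (fib (Suc m)) - 3 * int (fib m))) - (x - 2)"
  \<comment> \<open>Since \<open>x\<close> is independent of \<open>m\<close>, only the upper bound
    moves; the step needs just the Fibonacci recurrence.\<close>
  by (induction m) (simp_all add: algebra_simps)

theorem corollary3p2:
  fixes n :: nat
  assumes "n \<ge> 5"
  shows "(\<Sum>i = 1..n - 5. (int n - int i) * (-1) ^ i * int (fib i))
           + 6 * (-1) ^ (n - 4) * int (fib (n - 4))
         = (-1) ^ n * int (fib (n - 1)) - (int n - 2)"
proof -
  obtain m where n: "n = m + 5"
    using assms by (metis add.commute le_iff_add)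
  \<comment> \<open>This rewrites the target \<open>fib (n - 1)\<close> in the two values that the
    closed form uses.\<close>
  have "fib (m + 4) = 3 * fib (Suc m) + 2 * fib m"
    by (simp add: eval_nat_numeral)
  then show ?thesis
    \<comment> \<open>Here \<open>x - int m\<close> is 5, so the bracket is
      \<open>3 * fib (Suc m) - 2 * fib m\<close>. The extra term has sign
      \<open>(-1) ^ (m + 1)\<close> and turns 3 into -3; the common minus sign is absorbed by
      \<open>(-1) ^ (m + 5)\<close>.\<close>
    unfolding n sum_linear_alternating_fib by (simp add: power_add algebra_simps)
qed

end
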